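(* Let $(d,\delta,\beta,\gamma)$ be a vertex solution of (LP), that is, a vertex of the polyhedron $P_\Delta$. Then there is at most one maximal connected component with fractional values (with respect to $x+d$).
   Context: Setting: $N,M\in\mathbb{N}$, $[N]:=\{1,\dots,N\}$, $\Xi\subset\mathbb{Z}$ is a finite contiguous set of integers, $x\in\Xi^{N\times M}$, $c\in\mathbb{R}^{N\times M}$, $\alpha>0$, $\Delta\in\mathbb{N}$. The polyhedron $P$ is the set of all real tuples $(d,\delta,\beta,\gamma)$, $d,\delta\in\mathbb{R}^{N\times M}$, $\beta\in\mathbb{R}^{(N-1)\times M}$, $\gamma\in\mathbb{R}^{N\times(M-1)}$, with - $\min\Xi\le x_{i,j}+d_{i,j}\le\max\Xi$ for $i\in[N],j\in[M]$; - $-\beta_{i,j}\le x_{i+1,j}+d_{i+1,j}-x_{i,j}-d_{i,j}\le\beta_{i,j}$ for $i\in[N-1],j\in[M]$; - $-\gamma_{i,j}\le x_{i,j+1}+d_{i,j+1}-x_{i,j}-d_{i,j}\le\gamma_{i,j}$ for $i\in[N],j\in[M-1]$; - $-\delta_{i,j}\le d_{i,j}\le\delta_{i,j}$ for $i\in[N],j\in[M]$. $P_\Delta:=\{(d,\delta,\beta,\gamma)\in P:\sum_{i=1}^N\sum_{j=1}^M\delta_{i,j}\le\Delta\}$. (LP) is the linear program of minimizing $\sum_{i,j}c_{i,j}d_{i,j}+\alpha\bigl(\sum_{j=1}^M\sum_{i=1}^{N-1}\beta_{i,j}+\sum_{i=1}^N\sum_{j=1}^{M-1}\gamma_{i,j}\bigr)$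 over $(d,\delta,\beta,\gamma)\in P_\Delta$. Let $\Omega:=[N]\times[M]$ be the set of index pairs; two index pairs are adjacent if they differ by exactly one in exactly one coordinate and agree in the other. The value of the index pair $(i,j)$ is $x_{i,j}+d_{i,j}$. A connected component is a nonempty subset of $\Omega$ that is connected with respect to adjacency and all of whose index pairs have the same value. It is maximal if every index pair of $\Omega$ outside of the subset which is adjacent to an element of the subset has a different value. A connected component has fractional values if its common value is not in $\Xi$ (equivalently, is not an integer). *)

theory Defs
  imports "HOL-Analysis.Analysis" "HOL-Library.Function_Algebras"
begin

text \<open>Pointwise scaling makes \<^typ>\<open>'a \<Rightarrow> 'b\<close> a real vector space; addition
  on functions is pointwise already.\<close>

instantiation "fun" :: (type, real_vector) real_vector
begin

definition scaleR_fun :: "real \<Rightarrow> ('a \<Rightarrow> 'b) \<Rightarrow> 'a \<Rightarrow> 'b" where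
  "scaleR_fun r f = (\<lambda>x. r *\<^sub>R f x)"

instance
  by standard (simp_all add: scaleR_fun_def fun_eq_iff scaleR_add_right scaleR_add_left)

end

type_synonym grid = "nat \<Rightarrow> nat \<Rightarrow> real"

text \<open>Arrays in $\mathbb{R}^{n \times m}$, with rows $1,\dots,n$ and columns $1,\dots,m$, are
  the functions that vanish outside these index ranges.  Without this restriction the polyhedra
  below would contain lines and hence have no extreme points.\<close>

definition arrays :: "nat \<Rightarrow> nat \<Rightarrow> grid set" where
  "arrays n m = {a. \<forall>i j. a i j \<noteq> 0 \<longrightarrow> i \<in> {1..n} \<and> j \<in> {1..m}}"

definition polyhedron_P ::
    "nat \<Rightarrow> nat \<Rightarrow> int set \<Rightarrow> (nat \<Rightarrow> nat \<Rightarrow> int) \<Rightarrow> (grid \<times> grid \<times> grid \<times> grid) set" where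
  "polyhedron_P N M \<Xi> x = {(d, \<delta>, \<beta>, \<gamma>).
     d \<in> arrays N M \<and> \<delta> \<in> arrays N M \<and> \<beta> \<in> arrays (N - 1) M \<and> \<gamma> \<in> arrays N (M - 1) \<and>
     (\<forall>i\<in>{1..N}. \<forall>j\<in>{1..M}.
        of_int (Min \<Xi>) \<le> of_int (x i j) + d i j \<and> of_int (x i j) + d i j \<le> of_int (Max \<Xi>)) \<and>
     (\<forall>i\<in>{1..N - 1}. \<forall>j\<in>{1..M}.
        - \<beta> i j \<le> of_int (x (i + 1) j) + d (i + 1) j - of_int (x i j) - d i j \<and>
        of_int (x (i + 1) j) + d (i + 1) j - of_int (x i j) - d i j \<le> \<beta> i j) \<and>
     (\<forall>i\<in>{1..N}. \<forall>j\<in>{1..M - 1}.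
        - \<gamma> i j \<le> of_int (x i (j + 1)) + d i (j + 1) - of_int (x i j) - d i j \<and>
        of_int (x i (j + 1)) + d i (j + 1) - of_int (x i j) - d i j \<le> \<gamma> i j) \<and>
     (\<forall>i\<in>{1..N}. \<forall>j\<in>{1..M}. - \<delta> i j \<le> d i j \<and> d i j \<le> \<delta> i j)}"

definition polyhedron_P_Delta ::
    "nat \<Rightarrow> nat \<Rightarrow> int set \<Rightarrow> (nat \<Rightarrow> nat \<Rightarrow> int) \<Rightarrow> nat \<Rightarrow> (grid \<times> grid \<times> grid \<times> grid) set" where
  "polyhedron_P_Delta N M \<Xi> x \<Delta> =
     {(d, \<delta>, \<beta>, \<gamma>) \<in> polyhedron_P N M \<Xi> x. (\<Sum>i=1..N. \<Sum>j=1..M. \<delta> i j) \<le> real \<Delta>}"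

definition index_pairs :: "nat \<Rightarrow> nat \<Rightarrow> (nat \<times> nat) set" where
  "index_pairs N M = {1..N} \<times> {1..M}"

definition adjacent :: "nat \<times> nat \<Rightarrow> nat \<times> nat \<Rightarrow> bool" where
  "adjacent p q \<longleftrightarrow>
     (fst p = fst q \<and> (snd p = snd q + 1 \<or> snd q = snd p + 1)) \<or>
     (snd p = snd q \<and> (fst p = fst q + 1 \<or> fst q = fst p + 1))"

definition adj_connected :: "(nat \<times> nat) set \<Rightarrow> bool" where
  "adj_connected C \<longleftrightarrow>
     (\<forall>p\<in>C. \<forall>q\<in>C. (p, q) \<in> {(r, s). r \<in> C \<and> s \<in> C \<and> adjacent r s}\<^sup>*)"

text \<open>The argument \<open>v\<close> below assigns values to index pairs.\<close>

definition conn_component :: "nat \<Rightarrow> nat \<Rightarrow> grid \<Rightarrow> (nat \<times> nat) set \<Rightarrow> bool" where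
  "conn_component N M v C \<longleftrightarrow>
     C \<noteq> {} \<and> C \<subseteq> index_pairs N M \<and> adj_connected C \<and>
     (\<forall>(i, j)\<in>C. \<forall>(k, l)\<in>C. v i j = v k l)"

definition max_conn_component :: "nat \<Rightarrow> nat \<Rightarrow> grid \<Rightarrow> (nat \<times> nat) set \<Rightarrow> bool" where
  "max_conn_component N M v C \<longleftrightarrow>
     conn_component N M v C \<and>
     (\<forall>(k, l) \<in> index_pairs N M - C. \<forall>(i, j) \<in> C. adjacent (k, l) (i, j) \<longrightarrow> v k l \<noteq> v i j)"

definition fractional_values :: "int set \<Rightarrow> grid \<Rightarrow> (nat \<times> nat) set \<Rightarrow> bool" where
  "fractional_values \<Xi> v C \<longleftrightarrow> (\<forall>(i, j)\<in>C. v i j \<notin> real_of_int ` \<Xi>)"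

end

theory Submission
  imports Defs
begin

text \<open>
  Two distinct maximal components \<open>C\<close> and \<open>D\<close> with fractional values leave room for a line segment
  around the given point.  Raise all values on \<open>C\<close> by \<open>s\<close> and all values on \<open>D\<close> by \<open>t\<close>, and let
  \<open>\<delta>\<close>, \<open>\<beta>\<close> and \<open>\<gamma>\<close> follow the absolute values that they dominate.  The value range is not left by a
  small move because fractional values differ from its two integer ends.  The absolute values
  \<open>\<bar>d\<bar>\<close> and \<open>\<bar>v p - v q\<bar>\<close> vary linearly under a small move: wherever the
  values are raised, \<open>d\<close> is nonzero, because \<open>x\<close> is integral; and adjacent index pairs of equal value
  lie in the same maximal component or in none, so that they are raised equally
  (\<open>max_conn_component_adjacent_iff\<close>).  Hence the gaps between \<open>\<delta>\<close>, \<open>\<beta>\<close>, \<open>\<gamma>\<close>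
  and the absolute values that they dominate are preserved exactly, and only the budget constraint
  on \<open>\<delta>\<close> can fail (\<open>move_in_polyhedron\<close>).

  The budget changes at a rate that is a linear form in \<open>(s, t)\<close>.  A linear form in two unknowns has
  a nontrivial zero, and this is where the second component is needed.  For such \<open>(s, t)\<close> the move
  and its opposite both stay in the polyhedron, so the point is the midpoint of two other points
  of the polyhedron, hence not extreme (\<open>extreme_point_no_move\<close>).
\<close>

section \<open>Extreme points and absolute values\<close>

lemma extreme_point_of_add_diff_eq_zero:
  fixes z w :: "'a::real_vector"
  assumes "z extreme_point_of S" "z + w \<in> S" "z - w \<in> S"
  shows "w = 0"
proof (rule ccontr)
  assume "w \<noteq> 0"
  have "z = midpoint (z + w) (z - w)"
    by (simp add: midpoint_def scaleR_2[symmetric])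
  moreover have "z + w \<noteq> z - w"
  proof
    assume "z + w = z - w"
    then have "2 *\<^sub>R w = 0" by (simp add: scaleR_2 algebra_simps)
    with \<open>w \<noteq> 0\<close> show False by simp
  qed
  ultimately have "z \<in> open_segment (z + w) (z - w)"
    by (metis midpoint_in_open_segment)
  then show False using assms unfolding extreme_point_of_def by blast
qed

lemma abs_add_le_add_sgn_mult:
  fixes a h b :: real
  assumes "\<bar>a\<bar> \<le> b" "\<bar>h\<bar> \<le> \<bar>a\<bar>"
  shows "\<bar>a + h\<bar> \<le> b + sgn a * h"
  using assms by (auto simp: sgn_if abs_if split: if_splits)

lemma eventually_abs_mult_le:
  fixes f g :: real
  assumes "f = 0 \<Longrightarrow> g = 0"
  shows "\<forall>\<^sub>F \<epsilon> in at_right 0. \<bar>\<epsilon> * g\<bar> \<le> \<bar>f\<bar>"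
proof (cases "f = 0")
  case False
  have "((\<lambda>\<epsilon>. \<bar>\<epsilon> * g\<bar>) \<longlongrightarrow> \<bar>0 * g\<bar>) (at_right 0)"
    by (intro tendsto_intros)
  then have "\<forall>\<^sub>F \<epsilon> in at_right 0. \<bar>\<epsilon> * g\<bar> < \<bar>f\<bar>"
    by (rule order_tendstoD) (use False in simp)
  then show ?thesis by eventually_elim simp
qed (use assms in simp)

section \<open>Moves that follow the absolute values\<close>

text \<open>The changes of \<open>\<delta>\<close>, \<open>\<beta>\<close> and \<open>\<gamma>\<close> are the derivatives, in direction \<open>e\<close>, of the absolute values
  that they dominate.  For \<open>\<beta>\<close> and \<open>\<gamma>\<close> they are cut off, since differences of \<open>e\<close> across
  the border of the grid need not vanish.\<close>

definition move :: "nat \<Rightarrow> nat \<Rightarrow> grid \<Rightarrow> grid \<Rightarrow> grid \<Rightarrow> grid \<times> grid \<times> grid \<times> grid" where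
  "move N M v d e =
    (e,
     \<lambda>i j. sgn (d i j) * e i j,
     \<lambda>i j. if i \<in> {1..N - 1} \<and> j \<in> {1..M}
           then sgn (v (i + 1) j - v i j) * (e (i + 1) j - e i j) else 0,
     \<lambda>i j. if i \<in> {1..N} \<and> j \<in> {1..M - 1}
           then sgn (v i (j + 1) - v i j) * (e i (j + 1) - e i j) else 0)"

lemma move_uminus: "move N M v d (- e) = - move N M v d e"
  by (auto simp: move_def fun_eq_iff algebra_simps)

lemma arrays_add: "a \<in> arrays n m \<Longrightarrow> b \<in> arrays n m \<Longrightarrow> a + b \<in> arrays n m"
  by (simp add: arrays_def) (metis add.right_neutral)

text \<open>The bounds say that adding \<open>e\<close> changes the sign of none of the quantities whose absolute values
  or signs enter the constraints, so that these absolute values are linear along the move and the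
  values stay in their range.\<close>

definition small_move :: "nat \<Rightarrow> nat \<Rightarrow> int set \<Rightarrow> grid \<Rightarrow> grid \<Rightarrow> grid \<Rightarrow> bool" where
  "small_move N M \<Xi> v d e \<longleftrightarrow> e \<in> arrays N M \<and>
     (\<forall>i\<in>{1..N}. \<forall>j\<in>{1..M}.
        \<bar>e i j\<bar> \<le> \<bar>v i j - of_int (Min \<Xi>)\<bar> \<and> \<bar>e i j\<bar> \<le> \<bar>v i j - of_int (Max \<Xi>)\<bar> \<and>
        \<bar>e i j\<bar> \<le> \<bar>d i j\<bar>) \<and>
     (\<forall>i\<in>{1..N - 1}. \<forall>j\<in>{1..M}. \<bar>e (i + 1) j - e i j\<bar> \<le> \<bar>v (i + 1) j - v i j\<bar>) \<and>
     (\<forall>i\<in>{1..N}. \<forall>j\<in>{1..M - 1}. \<bar>e i (j + 1) - e i j\<bar> \<le> \<bar>v i (j + 1) - v i j\<bar>)"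

lemma small_move_uminus: "small_move N M \<Xi> v d (- e) \<longleftrightarrow> small_move N M \<Xi> v d e"
  by (simp add: small_move_def arrays_def abs_minus_commute)

lemma move_in_polyhedron:
  fixes x :: "nat \<Rightarrow> nat \<Rightarrow> int" and d :: grid
  assumes v_def: "v = (\<lambda>i j. of_int (x i j) + d i j)"
    and z: "(d, \<delta>, \<beta>, \<gamma>) \<in> polyhedron_P_Delta N M \<Xi> x \<Delta>"
    and small: "small_move N M \<Xi> v d e"
    and budget: "(\<Sum>i=1..N. \<Sum>j=1..M. sgn (d i j) * e i j) = 0"
  shows "(d, \<delta>, \<beta>, \<gamma>) + move N M v d e \<in> polyhedron_P_Delta N M \<Xi> x \<Delta>"
proof -
  obtain \<delta>' \<beta>' \<gamma>' where m: "move N M v d e = (e, \<delta>', \<beta>', \<gamma>')"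
    by (simp add: move_def)
  have \<delta>': "\<delta>' i j = sgn (d i j) * e i j" for i j
    using m by (auto simp: move_def)
  have \<beta>': "\<beta>' i j = sgn (v (i + 1) j - v i j) * (e (i + 1) j - e i j)"
    if "i \<in> {1..N - 1}" "j \<in> {1..M}" for i j
    using m that by (auto simp: move_def)
  have \<gamma>': "\<gamma>' i j = sgn (v i (j + 1) - v i j) * (e i (j + 1) - e i j)"
    if "i \<in> {1..N}" "j \<in> {1..M - 1}" for i j
    using m that by (auto simp: move_def)
  have e: "e \<in> arrays N M" using small by (simp add: small_move_def)
  have arrays': "\<delta>' \<in> arrays N M" "\<beta>' \<in> arrays (N - 1) M" "\<gamma>' \<in> arrays N (M - 1)"
    using m e by (auto simp: move_def arrays_def split: if_splits)
  have P: "(d, \<delta>, \<beta>, \<gamma>) \<in> polyhedron_P N M \<Xi> x"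
    and sum_le: "(\<Sum>i=1..N. \<Sum>j=1..M. \<delta> i j) \<le> real \<Delta>"
    using z by (auto simp: polyhedron_P_Delta_def)
  have range: "of_int (Min \<Xi>) \<le> of_int (x i j) + (d + e) i j"
      "of_int (x i j) + (d + e) i j \<le> of_int (Max \<Xi>)"
    if "i \<in> {1..N}" "j \<in> {1..M}" for i j
  proof -
    have "of_int (Min \<Xi>) \<le> v i j" "v i j \<le> of_int (Max \<Xi>)"
      using P that unfolding polyhedron_P_def v_def by blast+
    moreover have "\<bar>e i j\<bar> \<le> \<bar>v i j - of_int (Min \<Xi>)\<bar>" "\<bar>e i j\<bar> \<le> \<bar>v i j - of_int (Max \<Xi>)\<bar>"
      using small that unfolding small_move_def by blast+
    ultimately show "of_int (Min \<Xi>) \<le> of_int (x i j) + (d + e) i j"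
      "of_int (x i j) + (d + e) i j \<le> of_int (Max \<Xi>)"
      unfolding v_def plus_fun_apply by linarith+
  qed
  have \<delta>_bound: "\<bar>(d + e) i j\<bar> \<le> (\<delta> + \<delta>') i j" if "i \<in> {1..N}" "j \<in> {1..M}" for i j
  proof -
    have "- \<delta> i j \<le> d i j \<and> d i j \<le> \<delta> i j"
      using P that unfolding polyhedron_P_def by blast
    then have "\<bar>d i j\<bar> \<le> \<delta> i j" by linarith
    moreover have "\<bar>e i j\<bar> \<le> \<bar>d i j\<bar>" using small that unfolding small_move_def by blast+
    ultimately show ?thesis
      using abs_add_le_add_sgn_mult by (simp add: \<delta>')
  qed
  have \<beta>_bound: "\<bar>(v (i + 1) j - v i j) + (e (i + 1) j - e i j)\<bar> \<le> (\<beta> + \<beta>') i j"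
    if "i \<in> {1..N - 1}" "j \<in> {1..M}" for i j
  proof -
    have "- \<beta> i j \<le> of_int (x (i + 1) j) + d (i + 1) j - of_int (x i j) - d i j \<and>
        of_int (x (i + 1) j) + d (i + 1) j - of_int (x i j) - d i j \<le> \<beta> i j"
      using P that unfolding polyhedron_P_def by blast
    then have "\<bar>v (i + 1) j - v i j\<bar> \<le> \<beta> i j"
      unfolding v_def by linarith
    moreover have "\<bar>e (i + 1) j - e i j\<bar> \<le> \<bar>v (i + 1) j - v i j\<bar>"
      using small that unfolding small_move_def by blast+
    ultimately show ?thesis
      using abs_add_le_add_sgn_mult by (simp only: \<beta>'[OF that] plus_fun_apply)
  qed
  have \<gamma>_bound: "\<bar>(v i (j + 1) - v i j) + (e i (j + 1) - e i j)\<bar> \<le> (\<gamma> + \<gamma>') i j"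
    if "i \<in> {1..N}" "j \<in> {1..M - 1}" for i j
  proof -
    have "- \<gamma> i j \<le> of_int (x i (j + 1)) + d i (j + 1) - of_int (x i j) - d i j \<and>
        of_int (x i (j + 1)) + d i (j + 1) - of_int (x i j) - d i j \<le> \<gamma> i j"
      using P that unfolding polyhedron_P_def by blast
    then have "\<bar>v i (j + 1) - v i j\<bar> \<le> \<gamma> i j"
      unfolding v_def by linarith
    moreover have "\<bar>e i (j + 1) - e i j\<bar> \<le> \<bar>v i (j + 1) - v i j\<bar>"
      using small that unfolding small_move_def by blast+
    ultimately show ?thesis
      using abs_add_le_add_sgn_mult by (simp only: \<gamma>'[OF that] plus_fun_apply)
  qed
  have "(\<Sum>i=1..N. \<Sum>j=1..M. (\<delta> + \<delta>') i j) \<le> real \<Delta>"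
    using sum_le budget by (simp add: \<delta>' sum.distrib)
  moreover have "(d + e, \<delta> + \<delta>', \<beta> + \<beta>', \<gamma> + \<gamma>') \<in> polyhedron_P N M \<Xi> x"
  proof -
    have "d + e \<in> arrays N M" "\<delta> + \<delta>' \<in> arrays N M" "\<beta> + \<beta>' \<in> arrays (N - 1) M"
      "\<gamma> + \<gamma>' \<in> arrays N (M - 1)"
      using P e arrays' by (auto simp: polyhedron_P_def intro!: arrays_add)
    moreover have "- (\<beta> + \<beta>') i j
          \<le> of_int (x (i + 1) j) + (d + e) (i + 1) j - of_int (x i j) - (d + e) i j \<and>
        of_int (x (i + 1) j) + (d + e) (i + 1) j - of_int (x i j) - (d + e) i j \<le> (\<beta> + \<beta>') i j"
      if "i \<in> {1..N - 1}" "j \<in> {1..M}" for i j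
      using \<beta>_bound[OF that] unfolding v_def plus_fun_apply by linarith
    moreover have "- (\<gamma> + \<gamma>') i j
          \<le> of_int (x i (j + 1)) + (d + e) i (j + 1) - of_int (x i j) - (d + e) i j \<and>
        of_int (x i (j + 1)) + (d + e) i (j + 1) - of_int (x i j) - (d + e) i j \<le> (\<gamma> + \<gamma>') i j"
      if "i \<in> {1..N}" "j \<in> {1..M - 1}" for i j
      using \<gamma>_bound[OF that] unfolding v_def plus_fun_apply by linarith
    moreover have "- (\<delta> + \<delta>') i j \<le> (d + e) i j \<and> (d + e) i j \<le> (\<delta> + \<delta>') i j"
      if "i \<in> {1..N}" "j \<in> {1..M}" for i j
      using \<delta>_bound[OF that] unfolding abs_le_iff by linarith
    ultimately show ?thesis
      unfolding polyhedron_P_def using range by blast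
  qed
  ultimately show ?thesis
    by (simp add: m polyhedron_P_Delta_def)
qed

text \<open>The hypotheses \<open>ends\<close>, \<open>unchanged\<close> and \<open>adj\<close> say that \<open>e\<close> leaves each quantity that is zero at
  zero.  A nonzero quantity keeps its sign under a sufficiently small multiple of \<open>e\<close>.
  As there are finitely many quantities, one positive multiple of \<open>e\<close> is small for all of them, and
  moving by it forwards and backwards stays in the polyhedron.\<close>

lemma extreme_point_no_move:
  fixes x :: "nat \<Rightarrow> nat \<Rightarrow> int" and d :: grid
  assumes v_def: "v = (\<lambda>i j. of_int (x i j) + d i j)"
    and extreme: "(d, \<delta>, \<beta>, \<gamma>) extreme_point_of polyhedron_P_Delta N M \<Xi> x \<Delta>"
    and e: "e \<in> arrays N M"
    and ends: "\<And>i j. e i j \<noteq> 0 \<Longrightarrow> v i j \<noteq> of_int (Min \<Xi>) \<and> v i j \<noteq> of_int (Max \<Xi>)"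
    and unchanged: "\<And>i j. e i j \<noteq> 0 \<Longrightarrow> d i j \<noteq> 0"
    and adj: "\<And>i j k l. (i, j) \<in> index_pairs N M \<Longrightarrow> (k, l) \<in> index_pairs N M \<Longrightarrow>
      adjacent (i, j) (k, l) \<Longrightarrow> v i j = v k l \<Longrightarrow> e i j = e k l"
    and budget: "(\<Sum>i=1..N. \<Sum>j=1..M. sgn (d i j) * e i j) = 0"
  shows "e = 0"
proof -
  let ?z = "(d, \<delta>, \<beta>, \<gamma>)"
  have row: "e (i + 1) j - e i j = 0"
    if "i \<in> {1..N - 1}" "j \<in> {1..M}" "v (i + 1) j - v i j = 0" for i j
    using adj[of "i + 1" j i j] that by (auto simp: index_pairs_def adjacent_def)
  have col: "e i (j + 1) - e i j = 0"
    if "i \<in> {1..N}" "j \<in> {1..M - 1}" "v i (j + 1) - v i j = 0" for i j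
    using adj[of i "j + 1" i j] that by (auto simp: index_pairs_def adjacent_def)
  have "\<forall>\<^sub>F \<epsilon> in at_right (0::real). small_move N M \<Xi> v d (\<lambda>i j. \<epsilon> * e i j)"
    unfolding small_move_def right_diff_distrib[symmetric]
  proof (intro eventually_conj eventually_ball_finite ballI finite_atLeastAtMost
      eventually_abs_mult_le)
    show "\<forall>\<^sub>F \<epsilon> in at_right (0::real). (\<lambda>i j. \<epsilon> * e i j) \<in> arrays N M"
      using e by (intro always_eventually) (auto simp: arrays_def)
  qed (use ends unchanged row col in auto)
  moreover have "\<forall>\<^sub>F \<epsilon> in at_right (0::real). 0 < \<epsilon>"
    by (rule eventually_at_right_less)
  ultimately have "\<forall>\<^sub>F \<epsilon> in at_right (0::real). 0 < \<epsilon> \<and> small_move N M \<Xi> v d (\<lambda>i j. \<epsilon> * e i j)"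
    by eventually_elim simp
  then obtain \<epsilon> :: real where "0 < \<epsilon>" and small: "small_move N M \<Xi> v d (\<lambda>i j. \<epsilon> * e i j)"
    using eventually_happens[of _ "at_right (0::real)"] by auto
  define f where "f = (\<lambda>i j. \<epsilon> * e i j)"
  have budget_f: "(\<Sum>i=1..N. \<Sum>j=1..M. sgn (d i j) * f i j) = 0"
  proof -
    have "(\<Sum>i=1..N. \<Sum>j=1..M. sgn (d i j) * f i j)
        = \<epsilon> * (\<Sum>i=1..N. \<Sum>j=1..M. sgn (d i j) * e i j)"
      by (simp add: f_def sum_distrib_left mult.left_commute)
    then show ?thesis by (simp only: budget mult_zero_right)
  qed
  have z: "?z \<in> polyhedron_P_Delta N M \<Xi> x \<Delta>"
    using extreme by (simp add: extreme_point_of_def)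
  have "?z + move N M v d f \<in> polyhedron_P_Delta N M \<Xi> x \<Delta>"
    using z small budget_f unfolding f_def by (intro move_in_polyhedron[OF v_def])
  moreover have "?z + move N M v d (- f) \<in> polyhedron_P_Delta N M \<Xi> x \<Delta>"
    by (rule move_in_polyhedron[OF v_def z])
      (use small budget_f in \<open>simp_all add: small_move_uminus sum_negf f_def[symmetric]\<close>)
  ultimately have "move N M v d f = 0"
    using extreme_point_of_add_diff_eq_zero[OF extreme, of "move N M v d f"]
    by (simp only: move_uminus diff_conv_add_uminus)
  then have "f = 0" by (simp add: move_def zero_prod_def)
  then show "e = 0" using \<open>0 < \<epsilon>\<close> by (simp add: f_def fun_eq_iff)
qed

section \<open>Maximal connected components\<close>

lemma max_conn_component_adjacent:
  assumes "max_conn_component N M v C" "(i, j) \<in> C" "(k, l) \<in> index_pairs N M"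
    and "adjacent (k, l) (i, j)" "v k l = v i j"
  shows "(k, l) \<in> C"
  using assms unfolding max_conn_component_def by blast

lemma conn_component_value_eq:
  assumes "conn_component N M v C" "(i, j) \<in> C" "(k, l) \<in> C"
  shows "v i j = v k l"
  using assms unfolding conn_component_def by blast

lemma adjacent_sym: "adjacent p q \<Longrightarrow> adjacent q p"
  by (auto simp: adjacent_def)

text \<open>A maximal component swallows every path of constant value that starts in it.\<close>

lemma conn_component_subset_max_conn_component:
  assumes C: "conn_component N M v C" and D: "max_conn_component N M v D"
    and p: "p \<in> C" "p \<in> D"
  shows "C \<subseteq> D"
proof
  fix q assume "q \<in> C"
  with C p have "(p, q) \<in> {(r, s). r \<in> C \<and> s \<in> C \<and> adjacent r s}\<^sup>*"
    unfolding conn_component_def adj_connected_def by blast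
  then show "q \<in> D"
  proof (induction rule: rtrancl_induct)
    case base
    show ?case by fact
  next
    case (step r s)
    obtain i j k l where rs: "r = (i, j)" "s = (k, l)" by (metis surj_pair)
    have "(i, j) \<in> C" "(k, l) \<in> C" "adjacent (k, l) (i, j)"
      using step.hyps rs adjacent_sym by auto
    moreover from this have "v k l = v i j" using conn_component_value_eq[OF C] by blast
    moreover have "(k, l) \<in> index_pairs N M"
      using C \<open>(k, l) \<in> C\<close> unfolding conn_component_def by blast
    ultimately show ?case
      using max_conn_component_adjacent[OF D] step.IH rs by blast
  qed
qed

lemma max_conn_component_disjoint:
  assumes "max_conn_component N M v C" "max_conn_component N M v D" "C \<noteq> D"
  shows "C \<inter> D = {}"
proof (rule ccontr)
  assume "C \<inter> D \<noteq> {}"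
  then obtain p where "p \<in> C" "p \<in> D" by blast
  moreover have "conn_component N M v C" "conn_component N M v D"
    using assms unfolding max_conn_component_def by blast+
  ultimately have "C \<subseteq> D" "D \<subseteq> C"
    using assms conn_component_subset_max_conn_component by blast+
  with \<open>C \<noteq> D\<close> show False by blast
qed

lemma max_conn_component_adjacent_iff:
  assumes "max_conn_component N M v C"
    and "(i, j) \<in> index_pairs N M" "(k, l) \<in> index_pairs N M"
    and "adjacent (i, j) (k, l)" "v i j = v k l"
  shows "(i, j) \<in> C \<longleftrightarrow> (k, l) \<in> C"
  using assms max_conn_component_adjacent[OF assms(1)] adjacent_sym by metis

lemma linear_form_nontrivial_zero:
  fixes a b :: "'a::comm_ring_1"
  obtains s t where "s * a + t * b = 0" "s \<noteq> 0 \<or> t \<noteq> 0"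
proof (cases "a = 0 \<and> b = 0")
  case True
  then show ?thesis using that[of 1 0] by simp
next
  case False
  then show ?thesis using that[of b "- a"] by (auto simp: algebra_simps)
qed

section \<open>Uniqueness of the fractional component\<close>

theorem theorem3:
  fixes N M \<Delta> :: nat and \<Xi> :: "int set" and x :: "nat \<Rightarrow> nat \<Rightarrow> int"
    and d \<delta> \<beta> \<gamma> :: grid
  assumes "finite \<Xi>"
    and "\<And>a b. a \<in> \<Xi> \<Longrightarrow> b \<in> \<Xi> \<Longrightarrow> {a..b} \<subseteq> \<Xi>"
    and "\<And>i j. i \<in> {1..N} \<Longrightarrow> j \<in> {1..M} \<Longrightarrow> x i j \<in> \<Xi>"
    and "(d, \<delta>, \<beta>, \<gamma>) extreme_point_of polyhedron_P_Delta N M \<Xi> x \<Delta>"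
  shows "\<exists>\<^sub>\<le>\<^sub>1 C. max_conn_component N M (\<lambda>i j. of_int (x i j) + d i j) C \<and>
                fractional_values \<Xi> (\<lambda>i j. of_int (x i j) + d i j) C"
proof (rule Uniq_I, elim conjE, rule ccontr)
  define v :: grid where "v = (\<lambda>i j. of_int (x i j) + d i j)"
  fix C D
  assume "max_conn_component N M (\<lambda>i j. of_int (x i j) + d i j) C"
    and "max_conn_component N M (\<lambda>i j. of_int (x i j) + d i j) D"
    and "fractional_values \<Xi> (\<lambda>i j. of_int (x i j) + d i j) C"
    and "fractional_values \<Xi> (\<lambda>i j. of_int (x i j) + d i j) D"
    and "C \<noteq> D"
  then have C: "max_conn_component N M v C" and D: "max_conn_component N M v D"
    and frac: "fractional_values \<Xi> v C" "fractional_values \<Xi> v D"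
    by (simp_all add: v_def)
  then have disj: "C \<inter> D = {}" and ne: "C \<noteq> {}" "D \<noteq> {}"
    and sub: "C \<subseteq> index_pairs N M" "D \<subseteq> index_pairs N M"
    using max_conn_component_disjoint[OF C D \<open>C \<noteq> D\<close>]
    by (auto simp: max_conn_component_def conn_component_def)

  \<comment> \<open>The rate at which the budget is consumed when the values on \<open>K\<close> are raised
    with unit speed; it may be negative, where \<open>d\<close> is negative.\<close>
  define rate where
    "rate K = (\<Sum>i=1..N. \<Sum>j=1..M. sgn (d i j) * of_bool ((i, j) \<in> K))" for K
  obtain s t where st: "s * rate C + t * rate D = 0" "s \<noteq> 0 \<or> t \<noteq> 0"
    by (rule linear_form_nontrivial_zero)
  define e :: grid where "e = (\<lambda>i j. s * of_bool ((i, j) \<in> C) + t * of_bool ((i, j) \<in> D))"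
  have supp: "(i, j) \<in> C \<union> D" if "e i j \<noteq> 0" for i j
    using that by (auto simp: e_def)
  have not_in: "v i j \<notin> real_of_int ` \<Xi>" if "e i j \<noteq> 0" for i j
    using supp[OF that] frac by (auto simp: fractional_values_def)
  have x_in: "x i j \<in> \<Xi>" if "e i j \<noteq> 0" for i j
    using supp[OF that] sub assms(3) by (auto simp: index_pairs_def)

  have "e = 0"
  proof (rule extreme_point_no_move[OF v_def assms(4)])
    show "e \<in> arrays N M"
      using supp sub by (fastforce simp: arrays_def index_pairs_def)
    show "v i j \<noteq> of_int (Min \<Xi>) \<and> v i j \<noteq> of_int (Max \<Xi>)" if "e i j \<noteq> 0" for i j
      using not_in[OF that] x_in[OF that] Min_in[OF assms(1)] Max_in[OF assms(1)] by auto
    show "d i j \<noteq> 0" if "e i j \<noteq> 0" for i j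
      using not_in[OF that] x_in[OF that] by (auto simp: v_def)
    show "e i j = e k l"
      if "(i, j) \<in> index_pairs N M" "(k, l) \<in> index_pairs N M" "adjacent (i, j) (k, l)"
        "v i j = v k l" for i j k l
      unfolding e_def using that
      by (simp only: max_conn_component_adjacent_iff[OF C that]
          max_conn_component_adjacent_iff[OF D that])
    have "(\<Sum>i=1..N. \<Sum>j=1..M. sgn (d i j) * e i j) = s * rate C + t * rate D"
      by (simp only: e_def rate_def sum_distrib_left distrib_left sum.distrib mult.left_commute)
    then show "(\<Sum>i=1..N. \<Sum>j=1..M. sgn (d i j) * e i j) = 0"
      using st by simp
  qed
  then have e_zero: "e i j = 0" for i j by simp
  obtain i j k l where "(i, j) \<in> C" "(k, l) \<in> D" using ne by auto
  moreover from this have "(i, j) \<notin> D" "(k, l) \<notin> C" using disj by auto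
  ultimately have "s = 0" "t = 0"
    using e_zero[of i j] e_zero[of k l] by (simp_all add: e_def)
  with st show False by simp
qed

end
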